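(* Let $Y_1,Y_2,\ldots$ be i.i.d. copies of a complex-valued non-degenerate random variable. Let $k=k(n)$ be a sequence of positive integers satisfying $1\le k(n)\le\frac{\log n}{5\log\log n}$ for all sufficiently large $n$. Then for each $\varepsilon>0$, $$\lim_{n\to\infty}\mathbf{P}\left(\left|\sum_{1\le i_1<i_2<\cdots<i_k\le n}Y_{i_1}Y_{i_2}\cdots Y_{i_k}\right|\le e^{-\varepsilon n}\right)=0.$$
   Context: A complex-valued random variable is non-degenerate if it is not almost surely equal to a constant. *)

theory Defs
  imports "HOL-Probability.Probability"
begin

definition nondegenerate :: "'a measure \<Rightarrow> ('a \<Rightarrow> complex) \<Rightarrow> bool" where
  "nondegenerate M X \<longleftrightarrow> \<not> (\<exists>c. AE \<omega> in M. X \<omega> = c)"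

text \<open>The sequence is indexed from \<open>1\<close>; the value \<open>Y 0\<close> is unconstrained and never used.
  The random variable \<open>X\<close> being copied may live on another probability space \<open>N\<close>.\<close>

definition iid_copies ::
  "'a measure \<Rightarrow> (nat \<Rightarrow> 'a \<Rightarrow> complex) \<Rightarrow> 'b measure \<Rightarrow> ('b \<Rightarrow> complex) \<Rightarrow> bool" where
  "iid_copies M Y N X \<longleftrightarrow>
     prob_space.indep_vars M (\<lambda>_. borel) Y {1..} \<and>
     (\<forall>i\<ge>1. distr M borel (Y i) = distr N borel X)"

text \<open>An index tuple \<open>1 \<le> i\<^sub>1 < \<dots> < i\<^sub>k \<le> n\<close> is encoded as the strictly increasing list
  \<open>[i\<^sub>1, \<dots>, i\<^sub>k]\<close>.\<close>

definition increasing_tuples :: "nat \<Rightarrow> nat \<Rightarrow> nat list set" where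
  "increasing_tuples k n = {is. length is = k \<and> sorted_wrt (<) is \<and> set is \<subseteq> {1..n}}"

definition elem_sym :: "nat \<Rightarrow> nat \<Rightarrow> (nat \<Rightarrow> complex) \<Rightarrow> complex" where
  "elem_sym k n y = (\<Sum>is\<in>increasing_tuples k n. \<Prod>i\<leftarrow>is. y i)"

lemma finite_increasing_tuples: "finite (increasing_tuples k n)"
  by (rule finite_subset[OF _ finite_lists_length_eq[of "{1..n}" k]])
     (auto simp: increasing_tuples_def)

lemma elem_sym_eq_sum_subsets:
  "elem_sym k n y = (\<Sum>S | S \<subseteq> {1..n} \<and> card S = k. \<Prod>i\<in>S. y i)"
  unfolding elem_sym_def
proof (rule sum.reindex_bij_witness[where i = sorted_list_of_set and j = set])
  fix S assume "S \<in> {S. S \<subseteq> {1..n} \<and> card S = k}"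
  then have S: "S \<subseteq> {1..n}" "card S = k" "finite S"
    by (auto intro: finite_subset)
  then show "set (sorted_list_of_set S) = S" "sorted_list_of_set S \<in> increasing_tuples k n"
    by (auto simp: increasing_tuples_def)
next
  fix xs assume "xs \<in> increasing_tuples k n"
  then have xs: "sorted xs" "distinct xs" "length xs = k" "set xs \<subseteq> {1..n}"
    by (auto simp: increasing_tuples_def strict_sorted_iff)
  then show "sorted_list_of_set (set xs) = xs" "set xs \<in> {S. S \<subseteq> {1..n} \<and> card S = k}"
    by (auto simp: sorted_list_of_set.idem_if_sorted_distinct distinct_card)
  show "(\<Prod>i\<in>set xs. y i) = (\<Prod>i\<leftarrow>xs. y i)"
    using xs by (simp add: prod.distinct_set_conv_list)
qed

end

theory Submission
  imports Defs "HOL-Computational_Algebra.Fundamental_Theorem_Algebra" "HOL-Real_Asymp.Real_Asymp"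
begin

text \<open>Suppose first that some variables take only two values \<open>u \<noteq> v\<close> and the others are frozen.
  Then the \<open>k\<close>-th elementary symmetric polynomial is a polynomial of degree \<open>k\<close>, with leading
  coefficient \<open>(u - v)\<^sup>k / k!\<close>, in the number \<open>x\<close> of variables equal to \<open>u\<close>. At distance at least
  \<open>k\<^sup>2\<close> from its \<open>k\<close> roots it is bounded below by \<open>\<bar>u - v\<bar>\<^sup>k\<close> and grows so slowly that the bound
  survives when the values are only close to \<open>u\<close> or \<open>v\<close>, up to a total error small compared to
  \<open>\<bar>u - v\<bar>\<close>. Hence only \<open>O(k\<^sup>3)\<close> values of \<open>x\<close> are bad.

  To reach this situation, take independent pairs of copies of the variable and select one member
  of each pair by a fair coin, which does not change the joint law. Two points of the support have
  discs of radius about \<open>1/m\<close> near them of mass at least a constant times \<open>1/m\<^sup>2\<close>, so when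
  \<open>m\<close> is about \<open>n\<^bsup>1/10\<^esup>\<close>, with high probability at least \<open>2m\<close> of the pairs have
  one member in each disc. Flipping the coins of \<open>2m\<close> such pairs makes \<open>x\<close> binomial, and each value
  has probability \<open>O(m\<^bsup>-1/2\<^esup>)\<close>. The total is \<open>O(k\<^sup>3 m\<^bsup>-1/2\<^esup>) + o(1)\<close>, and \<open>k \<le> ln n\<close>.\<close>

section \<open>Elementary symmetric polynomials of two-valued data\<close>

text \<open>The product is multiplied out by the set \<open>T\<close> of factors contributing their
  summand with \<open>g\<close>. With \<open>f = 0\<close> this is Vieta's formula; with two-valued
  \<open>f\<close> and errors \<open>g\<close> it is the perturbation expansion.\<close>

lemma prod_linear_polys_expand:
  fixes f g :: "'b \<Rightarrow> 'a :: comm_ring_1"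
  assumes "finite A"
  shows "(\<Prod>i\<in>A. [:1, f i + g i:]) =
    (\<Sum>T\<in>Pow A. monom (\<Prod>i\<in>T. g i) (card T) * (\<Prod>i\<in>A - T. [:1, f i:]))"
proof -
  have "(\<Prod>i\<in>A. [:1, f i + g i:]) = (\<Prod>i\<in>A. monom (g i) 1 + [:1, f i:])"
    by (intro prod.cong) (auto simp: monom_Suc monom_0)
  also have "\<dots> = (\<Sum>T\<in>Pow A. (\<Prod>i\<in>T. monom (g i) 1) * (\<Prod>i\<in>A - T. [:1, f i:]))"
    by (rule prod_add[OF assms])
  also have "\<dots> = (\<Sum>T\<in>Pow A. monom (\<Prod>i\<in>T. g i) (card T) * (\<Prod>i\<in>A - T. [:1, f i:]))"
  proof (intro sum.cong refl)
    fix T assume "T \<in> Pow A"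
    then have "finite T" using assms finite_subset by auto
    then have "(\<Prod>i\<in>T. monom (g i) 1) = monom (\<Prod>i\<in>T. g i) (card T)"
      by induction (auto simp: mult_monom one_pCons monom_0)
    then show "(\<Prod>i\<in>T. monom (g i) 1) * (\<Prod>i\<in>A - T. [:1, f i:]) =
        monom (\<Prod>i\<in>T. g i) (card T) * (\<Prod>i\<in>A - T. [:1, f i:])" by simp
  qed
  finally show ?thesis .
qed

text \<open>In the form of a generating polynomial, splitting the variables into frozen and
  two-valued ones becomes a factorisation.\<close>

lemma elem_sym_eq_coeff: "elem_sym k n y = coeff (\<Prod>i\<in>{1..n}. [:1, y i:]) k"
proof -
  have "coeff (\<Prod>i\<in>{1..n}. [:1, 0 + y i:]) k =
      (\<Sum>T\<in>Pow {1..n}. if card T = k then \<Prod>i\<in>T. y i else 0)"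
    by (subst prod_linear_polys_expand)
       (auto simp: coeff_sum simp flip: one_pCons intro!: sum.cong)
  also have "\<dots> = (\<Sum>T | T \<subseteq> {1..n} \<and> card T = k. \<Prod>i\<in>T. y i)"
    by (subst sum.inter_filter[symmetric]) (auto intro!: sum.cong)
  finally show ?thesis by (simp add: elem_sym_eq_sum_subsets)
qed

text \<open>The \<open>k\<close>-th elementary symmetric polynomial when \<open>x\<close> of \<open>N\<close> variables equal \<open>u\<close>, the
  other \<open>N - x\<close> equal \<open>v\<close>, and \<open>Q\<close> is the generating polynomial of the remaining variables.\<close>

definition two_level :: "nat \<Rightarrow> 'a poly \<Rightarrow> 'a \<Rightarrow> 'a \<Rightarrow> nat \<Rightarrow> nat \<Rightarrow> 'a::comm_ring_1" where
  "two_level k Q u v N x = coeff (Q * [:1, u:] ^ x * [:1, v:] ^ (N - x)) k"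

text \<open>Put \<open>[:1, u:] = monom w 1 + [:1, v:]\<close> with \<open>w = u - v\<close> and
  expand the \<open>x\<close>-th power. The powers of \<open>[:1, v:]\<close> in term
  \<open>j\<close> add up to \<open>N - j\<close>, so this term is \<open>x choose j\<close>, a
  polynomial of degree \<open>j\<close> in \<open>x\<close>, times a factor independent of
  \<open>x\<close>. Terms with \<open>j > k\<close> do not reach the \<open>k\<close>-th
  coefficient.\<close>

lemma two_level_polynomial:
  fixes u v :: "'a :: field_char_0"
  assumes "coeff Q 0 = 1" "u \<noteq> v"
  obtains p where "degree p = k" "lead_coeff p = (u - v) ^ k / fact k"
    "\<And>x. x \<le> N \<Longrightarrow> poly p (of_nat x) = two_level k Q u v N x"
proof -
  define w where "w = u - v"
  \<comment> \<open>For \<open>j > N\<close> the exponent truncates to 0. This is harmless, since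
    then \<open>x choose j\<close> vanishes for all \<open>x \<le> N\<close>. The value
    \<open>c k\<close> is a constant coefficient, hence 1 for every \<open>N\<close>, and the degree
    is exactly \<open>k\<close>.\<close>
  define c where "c j = coeff (Q * [:1, v:] ^ (N - j)) (k - j)" for j
  \<comment> \<open>Falling factorials: the value of \<open>ff j\<close> at \<open>x\<close> is
    \<open>fact j\<close> times \<open>x choose j\<close>.\<close>
  define ff :: "nat \<Rightarrow> 'a poly" where "ff j = (\<Prod>i<j. [:- of_nat i, 1:])" for j
  define p where "p = (\<Sum>j\<le>k. smult (w ^ j * c j / fact j) (ff j))"
  have deg_ff: "degree (ff j) = j" for j
    unfolding ff_def by (subst degree_prod_eq_sum_degree) auto
  have lead_ff: "coeff (ff j) j = 1" for j
    using lead_coeff_prod[of "\<lambda>i. [:- of_nat i, 1 :: 'a:]" "{..<j}"] deg_ff[of j]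
    by (simp add: ff_def)
  have ck: "c k = 1"
    using assms by (simp add: c_def coeff_mult coeff_0_power)
  have "coeff p k = (\<Sum>j\<le>k. if j = k then w ^ k / fact k else 0)"
    unfolding p_def coeff_sum using ck lead_ff
    by (intro sum.cong) (auto simp: coeff_eq_0 deg_ff)
  then have pk: "coeff p k = w ^ k / fact k" by simp
  have "degree p \<le> k"
    unfolding p_def using deg_ff
    by (intro degree_sum_le) (auto intro: order_trans[OF degree_smult_le])
  moreover have "coeff p k \<noteq> 0" using pk assms by (simp add: w_def)
  ultimately have dk: "degree p = k" by (simp add: le_antisym le_degree)
  have "poly p (of_nat x) = two_level k Q u v N x" if "x \<le> N" for x
  proof -
    have summand: "coeff (Q * (of_nat (x choose j) * monom w 1 ^ j * [:1, v:] ^ (x - j)) * [:1, v:] ^ (N - x)) k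
       = (if j \<le> k then of_nat (x choose j) * w ^ j * c j else 0)" if "j \<le> x" for j
    proof -
      have m: "of_nat (x choose j) * monom w 1 ^ j = monom (of_nat (x choose j) * w ^ j) j"
        by (simp add: of_nat_poly monom_power smult_monom)
      have "[:1, v:] ^ (N - j) = [:1, v:] ^ (x - j) * [:1, v:] ^ (N - x)"
        using \<open>x \<le> N\<close> that by (simp flip: power_add)
      then have "Q * (of_nat (x choose j) * monom w 1 ^ j * [:1, v:] ^ (x - j)) * [:1, v:] ^ (N - x)
        = monom (of_nat (x choose j) * w ^ j) j * (Q * [:1, v:] ^ (N - j))"
        by (simp only: m mult_ac)
      then show ?thesis by (simp only: coeff_monom_mult c_def) simp
    qed
    have "[:1, u:] = monom w 1 + [:1, v:]" by (simp add: w_def monom_Suc monom_0)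
    then have "two_level k Q u v N x =
        (\<Sum>j\<le>x. coeff (Q * (of_nat (x choose j) * monom w 1 ^ j * [:1, v:] ^ (x - j)) * [:1, v:] ^ (N - x)) k)"
      by (simp add: two_level_def binomial_ring sum_distrib_left sum_distrib_right coeff_sum)
    also have "\<dots> = (\<Sum>j\<le>x. if j \<le> k then of_nat (x choose j) * w ^ j * c j else 0)"
      by (intro sum.cong) (use summand in auto)
    also have "\<dots> = (\<Sum>j\<in>{..x} \<inter> {..k}. of_nat (x choose j) * w ^ j * c j)"
      by (subst sum.inter_restrict) auto
    also have "\<dots> = (\<Sum>j\<le>k. of_nat (x choose j) * w ^ j * c j)"
      by (intro sum.mono_neutral_left) auto
    also have "\<dots> = (\<Sum>j\<le>k. w ^ j * c j / fact j * poly (ff j) (of_nat x))"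
      by (intro sum.cong)
         (auto simp: ff_def binomial_gbinomial gbinomial_prod_rev poly_prod atLeast0LessThan)
    finally show ?thesis by (simp add: p_def poly_sum)
  qed
  then show thesis using that[of p] dk pk by (simp add: w_def)
qed

text \<open>The left-hand coefficient is a mixed derivative in \<open>m\<close> of the two-valued variables; it is
  expressed by an \<open>m\<close>-th finite difference of \<open>two_level\<close> in \<open>x\<close>.\<close>

lemma coeff_monom_mult_two_level:
  fixes u v :: "'a :: comm_ring_1"
  assumes "m + x \<le> N"
  shows "(u - v) ^ m * coeff (monom 1 m * (Q * [:1, u:] ^ x * [:1, v:] ^ (N - m - x))) k =
    (\<Sum>j\<le>m. of_nat (m choose j) * (- 1) ^ (m - j) * two_level k Q u v N (x + j))"
proof -
  \<comment> \<open>Up to the factor \<open>u - v\<close>, the polynomial variable is the difference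
    of the two linear factors; the binomial expansion of its \<open>m\<close>-th power produces the
    finite difference.\<close>
  have "[:1, u:] + - [:1, v:] = monom (u - v) 1"
    by (simp add: monom_Suc monom_0)
  then have "smult ((u - v) ^ m) (monom 1 m) = ([:1, u:] + - [:1, v:]) ^ m"
    by (simp add: monom_power smult_monom)
  also have "\<dots> = (\<Sum>j\<le>m. of_nat (m choose j) * [:1, u:] ^ j * (- [:1, v:]) ^ (m - j))"
    by (rule binomial_ring)
  also have "\<dots> = (\<Sum>j\<le>m. smult (of_nat (m choose j) * (- 1) ^ (m - j)) ([:1, u:] ^ j * [:1, v:] ^ (m - j)))"
  proof (intro sum.cong refl)
    fix j
    have "(- [:1, v:]) ^ (m - j) = smult ((- 1) ^ (m - j)) ([:1, v:] ^ (m - j))"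
      using smult_power[of "- 1" "[:1, v:]" "m - j"] by simp
    then show "of_nat (m choose j) * [:1, u:] ^ j * (- [:1, v:]) ^ (m - j) =
      smult (of_nat (m choose j) * (- 1) ^ (m - j)) ([:1, u:] ^ j * [:1, v:] ^ (m - j))"
      by (simp add: of_nat_poly mult.commute)
  qed
  finally have *: "smult ((u - v) ^ m) (monom 1 m) = \<dots>" .
  have "(u - v) ^ m * coeff (monom 1 m * (Q * [:1, u:] ^ x * [:1, v:] ^ (N - m - x))) k =
    coeff (smult ((u - v) ^ m) (monom 1 m) * (Q * [:1, u:] ^ x * [:1, v:] ^ (N - m - x))) k"
    by simp
  also have "\<dots> = (\<Sum>j\<le>m. of_nat (m choose j) * (- 1) ^ (m - j) *
      coeff ([:1, u:] ^ j * [:1, v:] ^ (m - j) * (Q * [:1, u:] ^ x * [:1, v:] ^ (N - m - x))) k)"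
    unfolding * by (simp add: sum_distrib_right coeff_sum mult_smult_left del: mult_pCons_left mult_pCons_right)
  also have "\<dots> = (\<Sum>j\<le>m. of_nat (m choose j) * (- 1) ^ (m - j) * two_level k Q u v N (x + j))"
  proof (intro sum.cong refl)
    fix j assume "j \<in> {..m}"
    then have "N - (x + j) = (m - j) + (N - m - x)" using assms by simp
    then show "of_nat (m choose j) * (- 1) ^ (m - j) *
      coeff ([:1, u:] ^ j * [:1, v:] ^ (m - j) * (Q * [:1, u:] ^ x * [:1, v:] ^ (N - m - x))) k =
      of_nat (m choose j) * (- 1) ^ (m - j) * two_level k Q u v N (x + j)"
      by (simp only: two_level_def power_add mult_ac)
  qed
  finally show ?thesis .
qed

section \<open>Polynomials at natural numbers far from their roots\<close>

definition near_roots :: "complex poly \<Rightarrow> real \<Rightarrow> nat set" where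
  "near_roots p s = {x. \<exists>z. poly p z = 0 \<and> cmod (of_nat x - z) < s}"

text \<open>Two natural numbers closer than \<open>s\<close> to the same root differ by less than
  \<open>2 * s\<close>, so each root accounts for at most \<open>2 * s\<close> of them.\<close>

lemma card_near_roots:
  assumes "p \<noteq> 0"
  shows "finite (near_roots p (real s))" "card (near_roots p (real s)) \<le> degree p * (2 * s)"
proof -
  define C where "C z = {x::nat. cmod (of_nat x - z) < real s}" for z
  have C: "finite (C z) \<and> card (C z) \<le> 2 * s" for z
  proof (cases "C z = {}")
    case False
    define a where "a = (LEAST x. x \<in> C z)"
    have a: "a \<in> C z" and le: "\<And>x. x \<in> C z \<Longrightarrow> a \<le> x"
      using False unfolding a_def by (auto intro: LeastI Least_le)
    have "C z \<subseteq> {a..<a + 2 * s}"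
    proof
      fix x assume x: "x \<in> C z"
      have "real x - real a = cmod (of_nat x - of_nat a)"
        using le[OF x] by (simp add: norm_of_nat flip: of_nat_diff)
      also have "\<dots> \<le> cmod (of_nat x - z) + cmod (of_nat a - z)"
        by norm
      also have "\<dots> < 2 * real s" using x a by (simp add: C_def)
      finally show "x \<in> {a..<a + 2 * s}" using le[OF x] by simp
    qed
    then show ?thesis
      using card_mono[of "{a..<a + 2 * s}" "C z"] finite_subset by fastforce
  qed auto
  have eq: "near_roots p (real s) = (\<Union>z\<in>{z. poly p z = 0}. C z)"
    by (auto simp: near_roots_def C_def)
  have fin: "finite {z. poly p z = 0}" using poly_roots_finite[OF assms] .
  show "finite (near_roots p (real s))" unfolding eq using fin C by auto
  have "card (near_roots p (real s)) \<le> (\<Sum>z\<in>{z. poly p z = 0}. card (C z))"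
    unfolding eq using fin by (rule card_UN_le)
  also have "\<dots> \<le> card {z. poly p z = 0} * (2 * s)"
    using sum_bounded_above[of "{z. poly p z = 0}" "\<lambda>z. card (C z)" "2 * s"] C by auto
  also have "\<dots> \<le> degree p * (2 * s)"
    using card_poly_roots_bound[OF assms] by simp
  finally show "card (near_roots p (real s)) \<le> degree p * (2 * s)" .
qed

lemma norm_prod_mset_image:
  "norm (\<Prod>x\<in>#A. f x :: 'a :: real_normed_field) = (\<Prod>x\<in>#A. norm (f x))"
  by (induction A) (auto simp: norm_mult)

text \<open>Factor \<open>p\<close> over the complex numbers. At \<open>x\<close> every linear
  factor has modulus at least \<open>s\<close>, and moving by at most \<open>m\<close> enlarges it
  at most by the ratio \<open>1 + m / s\<close>.\<close>

lemma poly_away_from_roots: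
  assumes "p \<noteq> 0" "s > 0" "x \<notin> near_roots p s"
  shows "cmod (poly p (of_nat x)) \<ge> cmod (lead_coeff p) * s ^ degree p"
    and "cmod (y - of_nat x) \<le> m \<Longrightarrow>
      cmod (poly p y) \<le> (1 + m / s) ^ degree p * cmod (poly p (of_nat x))"
proof -
  obtain R where R: "size R = degree p" and p: "p = smult (lead_coeff p) (\<Prod>x\<in>#R. [:-x, 1:])"
    using alg_closed_imp_factorization[OF assms(1)] by blast
  have val: "cmod (poly p z) = cmod (lead_coeff p) * (\<Prod>r\<in>#R. cmod (z - r))" for z
    by (subst p) (simp add: poly_prod_mset norm_mult norm_prod_mset_image)
  have far: "cmod (of_nat x - r) \<ge> s" if "r \<in># R" for r
  proof -
    have "poly p r = 0" using that by (subst p) (auto simp: poly_prod_mset)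
    then show ?thesis using assms by (fastforce simp: near_roots_def not_less)
  qed
  \<comment> \<open>Inducting over submultisets of \<open>R\<close> keeps \<open>far\<close>
    applicable to each root that is added.\<close>
  have "s ^ size A \<le> (\<Prod>r\<in>#A. cmod (of_nat x - r))" if "A \<subseteq># R" for A
    using that
  proof (induction A)
    case (add r A)
    then have "r \<in># R" "A \<subseteq># R" using mset_subset_eq_insertD[OF add.prems] by (auto simp: subset_mset.less_imp_le)
    then show ?case using add.IH far[of r] assms(2) by (auto intro!: mult_mono)
  qed auto
  from this[of R] show "cmod (poly p (of_nat x)) \<ge> cmod (lead_coeff p) * s ^ degree p"
    unfolding val using R by (auto intro: mult_left_mono)
  assume m: "cmod (y - of_nat x) \<le> m"
  then have m0: "m \<ge> 0" using norm_ge_zero order_trans by blast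
  have "(\<Prod>r\<in>#A. cmod (y - r)) \<le> (1 + m / s) ^ size A * (\<Prod>r\<in>#A. cmod (of_nat x - r))" if "A \<subseteq># R" for A
    using that
  proof (induction A)
    case (add r A)
    then have r: "r \<in># R" "A \<subseteq># R" using mset_subset_eq_insertD[OF add.prems] by (auto simp: subset_mset.less_imp_le)
    have "cmod (y - r) \<le> m + cmod (of_nat x - r)"
      using m norm_triangle_ineq[of "y - of_nat x" "of_nat x - r"] by simp
    also have "\<dots> \<le> (1 + m / s) * cmod (of_nat x - r)"
      using far[OF r(1)] m0 assms(2) by (simp add: field_simps mult_mono')
    finally have "cmod (y - r) \<le> (1 + m / s) * cmod (of_nat x - r)" .
    moreover have "0 \<le> (\<Prod>r\<in>#A. cmod (y - r))" by (induction A) auto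
    ultimately show ?case using mult_mono[OF _ add.IH[OF r(2)]] m0 assms(2)
      by (fastforce simp: mult_ac)
  qed auto
  from this[of R] show "cmod (poly p y) \<le> (1 + m / s) ^ degree p * cmod (poly p (of_nat x))"
    unfolding val using R by (simp add: mult.left_commute mult_left_mono)
qed

section \<open>Perturbation of two-valued data\<close>

text \<open>The left side is at most \<open>(1 + 1 / k) ^ k\<close>, hence at most e. It is the
  growth factor of a polynomial of degree \<open>k\<close> under a shift by \<open>m\<close> at
  distance \<open>k ^ 2\<close> from its roots.\<close>

lemma one_plus_inverse_power_le:
  assumes "m \<le> k" "k > 0"
  shows "(1 + real m / real (k ^ 2)) ^ k \<le> 3"
proof -
  have "real m / real (k ^ 2) \<le> real k / real (k ^ 2)"
    using assms by (intro divide_right_mono) auto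
  also have "\<dots> = 1 / k" by (simp add: power2_eq_square)
  finally have "1 + real m / real (k ^ 2) \<le> exp (1 / k)"
    using exp_ge_add_one_self[of "1 / real k"] by linarith
  then have "(1 + real m / real (k ^ 2)) ^ k \<le> exp (1 / k) ^ k"
    by (intro power_mono) auto
  also have "\<dots> = exp 1" using assms by (simp flip: exp_of_nat_mult)
  finally show ?thesis using exp_le by linarith
qed

lemma sum_Pow_power_card:
  fixes c :: "'a :: comm_semiring_1"
  assumes "finite J"
  shows "(\<Sum>T\<in>Pow J. c ^ card T) = (c + 1) ^ card J"
  using prod_add[OF assms, of "\<lambda>_. c" "\<lambda>_. 1"] by simp

lemma exceptional_sizes:
  fixes y :: "'b \<Rightarrow> complex" and u v :: complex
  assumes "finite I" "J \<subseteq> I" "k > 0" "u \<noteq> v" "r \<ge> 0"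
    and small: "2 * r * real (card J) / cmod (u - v) \<le> 1 / 12"
  obtains S :: "nat set" where "finite S" "card S \<le> 2 * k ^ 3"
    "\<And>z A. (\<And>i. i \<in> I - J \<Longrightarrow> z i = y i) \<Longrightarrow> A \<subseteq> J \<Longrightarrow>
      (\<And>i. i \<in> A \<Longrightarrow> cmod (z i - u) \<le> r) \<Longrightarrow> (\<And>i. i \<in> J - A \<Longrightarrow> cmod (z i - v) \<le> r) \<Longrightarrow>
      card A \<notin> S \<Longrightarrow> cmod (coeff (\<Prod>i\<in>I. [:1, z i:]) k) \<ge> cmod (u - v) ^ k / 2"
proof -
  define N where "N = card J"
  define Q where "Q = (\<Prod>i\<in>I - J. [:1, y i:])"
  define w where "w = cmod (u - v)"
  have w0: "w > 0" using assms by (simp add: w_def)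
  have finJ: "finite J" using assms finite_subset by auto
  have "coeff Q 0 = 1" by (simp add: Q_def poly_prod flip: poly_0_coeff_0)
  then obtain p where p: "degree p = k" "lead_coeff p = (u - v) ^ k / fact k"
    "\<And>x. x \<le> N \<Longrightarrow> poly p (of_nat x) = two_level k Q u v N x"
    using two_level_polynomial[of Q u v k N] assms by blast
  have p0: "p \<noteq> 0" using p assms by auto
  define S where "S = near_roots p (real (k ^ 2))"
  show thesis
  proof (rule that[of S])
    show "finite S" unfolding S_def using card_near_roots(1)[OF p0] .
    show "card S \<le> 2 * k ^ 3" unfolding S_def using card_near_roots(2)[OF p0, of "k ^ 2"] p(1)
      by (simp add: power3_eq_cube power2_eq_square)
  next
    fix z A assume zy: "\<And>i. i \<in> I - J \<Longrightarrow> z i = y i" and A: "A \<subseteq> J"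
      and zu: "\<And>i. i \<in> A \<Longrightarrow> cmod (z i - u) \<le> r"
      and zv: "\<And>i. i \<in> J - A \<Longrightarrow> cmod (z i - v) \<le> r" and S: "card A \<notin> S"
    define x where "x = card A"
    have finA: "finite A" using A finJ finite_subset by auto
    have xN: "x \<le> N" unfolding x_def N_def using A finJ by (rule card_mono[rotated])
    define F where "F = cmod (poly p (of_nat x))"
    have k2: "real (k ^ 2) > 0" using assms by simp
    \<comment> \<open>The distance \<open>k ^ 2\<close> to each of the \<open>k\<close> roots
      outweighs the denominator \<open>fact k\<close> of the leading coefficient.\<close>
    have Fge: "F \<ge> w ^ k"
    proof -
      have "fact k \<le> (real k) ^ k" using fact_le_power[of k] by (metis of_nat_fact of_nat_le_iff of_nat_power)
      also have "\<dots> \<le> real (k ^ 2) ^ k"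
        using assms by (intro power_mono) (auto simp: power2_eq_square)
      finally have "w ^ k * 1 \<le> w ^ k * (real (k ^ 2) ^ k / fact k)"
        using w0 by (intro mult_left_mono) auto
      also have "\<dots> = cmod (lead_coeff p) * real (k ^ 2) ^ degree p"
        using p(1,2) by (simp add: w_def norm_divide norm_power)
      also have "\<dots> \<le> F" unfolding F_def
        by (rule poly_away_from_roots(1)[OF p0 k2]) (use S in \<open>auto simp: S_def x_def\<close>)
      finally show ?thesis by simp
    qed
    \<comment> \<open>The finite differences below evaluate \<open>two_level\<close> only at counts
      differing from \<open>x\<close> by at most \<open>m \<le> k\<close>.\<close>
    have Fnear: "cmod (two_level k Q u v N x') \<le> 3 * F"
      if "x' \<le> N" "x \<le> x' + m" "x' \<le> x + m" "m \<le> k" for x' m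
    proof -
      have "cmod (poly p (of_nat x')) \<le> (1 + real m / real (k ^ 2)) ^ degree p * F" unfolding F_def
      proof (rule poly_away_from_roots(2)[OF p0 k2])
        have "cmod (of_nat x' - of_nat x) = \<bar>real x' - real x\<bar>"
          by (metis norm_of_real of_real_diff of_real_of_nat_eq)
        then show "cmod (of_nat x' - of_nat x) \<le> real m" using that by linarith
      qed (use S in \<open>auto simp: S_def x_def\<close>)
      also have "\<dots> \<le> 3 * F" unfolding p(1)
        using one_plus_inverse_power_le[OF that(4)] assms by (intro mult_right_mono) (auto simp: F_def)
      finally show ?thesis using p(3)[OF that(1)] by simp
    qed
    \<comment> \<open>On \<open>J\<close>, \<open>z\<close> is split into exactly two-valued data
      \<open>b\<close> and an error \<open>\<eta>\<close>.\<close>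
    define b where "b i = (if i \<in> A then u else v)" for i
    define \<eta> where "\<eta> i = z i - b i" for i
    have eta: "cmod (\<eta> i) \<le> r" if "i \<in> J" for i
      using that zu zv by (auto simp: \<eta>_def b_def)
    define t where "t T = coeff (Q * (monom (\<Prod>i\<in>T. \<eta> i) (card T) * (\<Prod>i\<in>J - T. [:1, b i:]))) k" for T
    have "(\<Prod>i\<in>I. [:1, z i:]) = (\<Prod>i\<in>I - J. [:1, z i:]) * (\<Prod>i\<in>J. [:1, z i:])"
      using assms by (simp add: prod.subset_diff)
    also have "(\<Prod>i\<in>I - J. [:1, z i:]) = Q"
      unfolding Q_def by (intro prod.cong) (use zy in auto)
    also have "(\<Prod>i\<in>J. [:1, z i:]) = (\<Prod>i\<in>J. [:1, b i + \<eta> i:])" by (simp add: \<eta>_def)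
    finally have expand: "coeff (\<Prod>i\<in>I. [:1, z i:]) k = (\<Sum>T\<in>Pow J. t T)"
      by (simp add: prod_linear_polys_expand[OF finJ] sum_distrib_left coeff_sum t_def)
    have t_eq: "t T = (\<Prod>i\<in>T. \<eta> i) *
      coeff (monom 1 (card T) * (Q * [:1, u:] ^ card (A - T) * [:1, v:] ^ (N - card T - card (A - T)))) k"
      if "T \<subseteq> J" for T
    proof -
      have finT: "finite T" using that finJ finite_subset by auto
      have "(\<Prod>i\<in>J - T. [:1, b i:]) = (\<Prod>i\<in>A - T. [:1, b i:]) * (\<Prod>i\<in>J - T - (A - T). [:1, b i:])"
        using A finJ by (subst mult.commute) (intro prod.subset_diff, auto)
      also have "(\<Prod>i\<in>A - T. [:1, b i:]) = [:1, u:] ^ card (A - T)"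
        by (subst prod.cong[OF refl, of _ _ "\<lambda>_. [:1, u:]"]) (auto simp: b_def)
      also have "(\<Prod>i\<in>J - T - (A - T). [:1, b i:]) = [:1, v:] ^ card (J - T - (A - T))"
        by (subst prod.cong[OF refl, of _ _ "\<lambda>_. [:1, v:]"]) (auto simp: b_def)
      also have "card (J - T - (A - T)) = N - card T - card (A - T)"
        using A that finJ finT finA by (subst card_Diff_subset) (auto simp: card_Diff_subset N_def)
      finally have *: "(\<Prod>i\<in>J - T. [:1, b i:]) =
        [:1, u:] ^ card (A - T) * [:1, v:] ^ (N - card T - card (A - T))" .
      have **: "monom (\<Prod>i\<in>T. \<eta> i) (card T) = smult (\<Prod>i\<in>T. \<eta> i) (monom 1 (card T))"
        by (simp add: smult_monom)
      show ?thesis unfolding t_def * **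
        by (simp only: mult_smult_left mult_smult_right coeff_smult mult_ac)
    qed
    \<comment> \<open>The cost of one perturbed coordinate: \<open>r\<close> from its error,
      \<open>1 / w\<close> from passing from a derivative to a difference, and 2 from the sum of the
      binomial coefficients.\<close>
    define c where "c = 2 * r / w"
    have c0: "c \<ge> 0" using assms w0 by (simp add: c_def)
    have t_le: "cmod (t T) \<le> c ^ card T * (3 * F)" if T: "T \<subseteq> J" for T
    proof (cases "card T \<le> k")
      case False
      then have "t T = 0" unfolding t_eq[OF T] by (simp add: coeff_monom_mult)
      then show ?thesis using c0 by (simp add: F_def)
    next
      case True
      define m where "m = card T"
      define x' where "x' = card (A - T)"
      define D where "D = coeff (monom 1 m * (Q * [:1, u:] ^ x' * [:1, v:] ^ (N - m - x'))) k"
      have finT: "finite T" using that finJ finite_subset by auto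
      have "m + x' = card (T \<union> (A - T))"
        unfolding m_def x'_def using finT finA by (subst card_Un_disjoint) auto
      also have "\<dots> \<le> N" unfolding N_def using A T finJ by (intro card_mono) auto
      finally have mx: "m + x' \<le> N" .
      have x'x: "x' \<le> x" unfolding x'_def x_def using finA by (intro card_mono) auto
      have xx': "x \<le> x' + m" unfolding x'_def x_def m_def
        using diff_card_le_card_Diff[OF finT, of A] by linarith
      have "cmod ((u - v) ^ m * D) =
        cmod (\<Sum>j\<le>m. of_nat (m choose j) * (- 1) ^ (m - j) * two_level k Q u v N (x' + j))"
        unfolding D_def by (subst coeff_monom_mult_two_level[OF mx]) simp
      also have "\<dots> \<le> (\<Sum>j\<le>m. real (m choose j) * (3 * F))"
      proof (rule sum_norm_le)
        fix j assume j: "j \<in> {..m}"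
        have "cmod (two_level k Q u v N (x' + j)) \<le> 3 * F"
          by (rule Fnear[of _ m]) (use j mx x'x xx' True in \<open>auto simp: m_def\<close>)
        then show "cmod (of_nat (m choose j) * (- 1) ^ (m - j) * two_level k Q u v N (x' + j))
          \<le> real (m choose j) * (3 * F)"
          by (simp add: norm_mult norm_power mult_left_mono)
      qed
      also have "\<dots> = 2 ^ m * (3 * F)"
        using choose_row_sum[of m] by (simp flip: sum_distrib_right of_nat_sum)
      finally have D: "w ^ m * cmod D \<le> 2 ^ m * (3 * F)"
        by (simp add: norm_mult norm_power w_def)
      have "cmod (\<Prod>i\<in>T. \<eta> i) \<le> r ^ m"
        unfolding m_def prod_norm[symmetric] prod_constant[symmetric]
        using eta T by (intro prod_mono) auto
      then have "cmod (t T) \<le> r ^ m * cmod D"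
        unfolding t_eq[OF T] by (simp add: norm_mult m_def D_def x'_def mult_right_mono)
      also have "\<dots> = (r / w) ^ m * (w ^ m * cmod D)"
        using w0 by (simp add: power_divide)
      also have "\<dots> \<le> (r / w) ^ m * (2 ^ m * (3 * F))"
        using D assms w0 by (intro mult_left_mono) auto
      also have "\<dots> = c ^ card T * (3 * F)"
        by (simp add: c_def m_def power_divide power_mult_distrib)
      finally show ?thesis .
    qed
    have t0: "t {} = poly p (of_nat x)"
      using p(3)[OF xN] by (simp add: t_eq two_level_def x_def)
    have "(\<Sum>T\<in>Pow J. t T) = t {} + (\<Sum>T\<in>Pow J - {{}}. t T)"
      using finJ by (subst sum.remove[of _ "{}"]) auto
    then have diff: "coeff (\<Prod>i\<in>I. [:1, z i:]) k - poly p (of_nat x) = (\<Sum>T\<in>Pow J - {{}}. t T)"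
      using expand t0 by simp
    have "cmod (\<Sum>T\<in>Pow J - {{}}. t T) \<le> (\<Sum>T\<in>Pow J - {{}}. c ^ card T * (3 * F))"
      by (intro sum_norm_le) (use t_le in auto)
    also have "\<dots> = ((\<Sum>T\<in>Pow J. c ^ card T) - 1) * (3 * F)"
      using finJ by (subst (2) sum.remove[of _ "{}"]) (auto simp: sum_distrib_right)
    also have "\<dots> = ((c + 1) ^ N - 1) * (3 * F)"
      by (simp add: sum_Pow_power_card[OF finJ] N_def)
    also have "\<dots> \<le> 1 / 6 * (3 * F)"
    proof (intro mult_right_mono)
      \<comment> \<open>By the smallness hypothesis \<open>N * c\<close> is at most 1/12, which
        leaves the non-empty \<open>T\<close> a share of at most 1/6 of \<open>3 * F\<close>, that
        is \<open>F / 2\<close>.\<close>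
      have "(c + 1) ^ N \<le> exp c ^ N"
        using c0 exp_ge_add_one_self[of c] by (intro power_mono) (auto simp: add.commute)
      also have "\<dots> = exp (real N * c)" by (simp add: exp_of_nat_mult)
      also have "real N * c \<le> 1 / 12"
        using small by (simp add: c_def w_def N_def mult_ac)
      then have "exp (real N * c) \<le> exp (1 / 12)" by simp
      also have "exp (1 / 12 :: real) \<le> 1 + 1 / 12 + (1 / 12)\<^sup>2" by (rule exp_bound) auto
      also have "\<dots> \<le> 7 / 6" by (simp add: power2_eq_square)
      finally show "(c + 1) ^ N - 1 \<le> 1 / 6" by simp
    qed (auto simp: F_def)
    finally have "cmod (coeff (\<Prod>i\<in>I. [:1, z i:]) k - poly p (of_nat x)) \<le> F / 2"
      unfolding diff by simp
    moreover have "F \<le> cmod (coeff (\<Prod>i\<in>I. [:1, z i:]) k) + cmod (coeff (\<Prod>i\<in>I. [:1, z i:]) k - poly p (of_nat x))"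
      unfolding F_def by norm
    ultimately show "cmod (coeff (\<Prod>i\<in>I. [:1, z i:]) k) \<ge> cmod (u - v) ^ k / 2"
      using Fge unfolding w_def by linarith
  qed
qed

section \<open>Random selection from pairs\<close>

text \<open>The squared inequality is proved by induction: consecutive central binomial coefficients
  have ratio 2(2m+1)/(m+1), and (2m+1)(2m+3) is at most 4(m+1)^2.\<close>

lemma central_binomial_upper_bound: "real ((2 * m) choose m) \<le> 4 ^ m / sqrt (2 * real m + 1)"
proof -
  have rec: "Suc m * ((2 * Suc m) choose Suc m) = 2 * (2 * m + 1) * ((2 * m) choose m)" for m
  proof -
    have "Suc m * ((2 * Suc m) choose Suc m) = 2 * (Suc m * (Suc (2 * m) choose m))"
      using Suc_times_binomial_eq[of "Suc (2 * m)" m] by (simp add: algebra_simps del: binomial_Suc_Suc)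
    also have "(Suc (2 * m) choose m) = (Suc (2 * m) choose Suc m)"
      using binomial_symmetric[of m "Suc (2 * m)"] by (simp add: Suc_diff_le del: binomial_Suc_Suc)
    also have "Suc m * (Suc (2 * m) choose Suc m) = (2 * m + 1) * ((2 * m) choose m)"
      using Suc_times_binomial_eq[of "2 * m" m] by (simp add: mult.commute del: binomial_Suc_Suc)
    finally show ?thesis by simp
  qed
  have "(real ((2 * m) choose m))\<^sup>2 * (2 * real m + 1) \<le> 16 ^ m"
  proof (induction m)
    case (Suc m)
    define B where "B = real ((2 * m) choose m)"
    define C where "C = real ((2 * Suc m) choose Suc m)"
    have C: "(real m + 1) * C = 2 * (2 * real m + 1) * B"
      unfolding B_def C_def using arg_cong[OF rec[of m], of real] by (simp add: algebra_simps)
    have "(real m + 1)\<^sup>2 * (C\<^sup>2 * (2 * real (Suc m) + 1)) = ((real m + 1) * C)\<^sup>2 * (2 * real m + 3)"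
      by (simp add: power2_eq_square algebra_simps)
    also have "\<dots> = (B\<^sup>2 * (2 * real m + 1)) * (4 * (2 * real m + 1) * (2 * real m + 3))"
      unfolding C by (simp add: power2_eq_square algebra_simps)
    also have "\<dots> \<le> 16 ^ m * (16 * (real m + 1)\<^sup>2)"
    proof (rule mult_mono)
      show "4 * (2 * real m + 1) * (2 * real m + 3) \<le> 16 * (real m + 1)\<^sup>2"
        by (simp add: power2_eq_square algebra_simps)
    qed (use Suc.IH in \<open>auto simp: B_def\<close>)
    finally show ?case by (simp add: C_def mult_ac del: mult_Suc_right binomial_Suc_Suc)
  qed simp
  then have "sqrt ((real ((2 * m) choose m))\<^sup>2 * (2 * real m + 1)) \<le> sqrt ((4 ^ m)\<^sup>2)"
    by (intro real_sqrt_le_mono) (simp add: power_mult[symmetric] mult.commute[of m] power_mult)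
  then show ?thesis by (simp add: real_sqrt_mult pos_le_divide_eq)
qed

lemma card_subsets_with_size_in:
  assumes "finite J" "card J = 2 * m" "finite S"
  shows "card {A \<in> Pow J. card A \<in> S} \<le> card S * ((2 * m) choose m)"
proof -
  have "{A \<in> Pow J. card A \<in> S} = (\<Union>x\<in>S. {A. A \<subseteq> J \<and> card A = x})" by auto
  also have "card \<dots> \<le> (\<Sum>x\<in>S. card {A. A \<subseteq> J \<and> card A = x})"
    by (rule card_UN_le[OF assms(3)])
  also have "\<dots> \<le> card S * ((2 * m) choose m)"
    using sum_bounded_above[of S "\<lambda>x. card {A. A \<subseteq> J \<and> card A = x}" "(2 * m) choose m"]
    by (simp add: n_subsets[OF assms(1)] assms(2) binomial_maximum')
  finally show ?thesis .
qed

text \<open>A set \<open>E\<close> is determined by its part outside \<open>J\<close> and by its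
  symmetric difference with \<open>B\<close> inside \<open>J\<close>. For each outer part the set of
  forbidden sizes is fixed, and the count for subsets of \<open>J\<close> applies. In the
  application \<open>B\<close> holds the pairs whose first member is near \<open>u\<close>, so the
  symmetric difference consists of the indices where the selected member is near
  \<open>u\<close>.\<close>

lemma card_swaps_with_size_in:
  assumes "finite I" "J \<subseteq> I" "card J = 2 * m" "\<And>E. finite (S E)" "\<And>E. card (S E) \<le> s"
  shows "card {E \<in> Pow I. card {i \<in> J. (i \<in> B) \<noteq> (i \<in> E)} \<in> S (E - J)}
    \<le> 2 ^ (card I - 2 * m) * (s * ((2 * m) choose m))"
proof -
  have finJ: "finite J" using assms(1,2) by (rule finite_subset[rotated])
  define T where "T = (SIGMA E:Pow (I - J). {A \<in> Pow J. card A \<in> S E})"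
  define f where "f E = (E - J, {i \<in> J. (i \<in> B) \<noteq> (i \<in> E)})" for E
  have "inj_on f (Pow I)"
    by (rule inj_onI) (unfold f_def, blast)
  then have "card {E \<in> Pow I. card {i \<in> J. (i \<in> B) \<noteq> (i \<in> E)} \<in> S (E - J)} \<le> card T"
    using assms finJ by (intro card_inj_on_le[of f]) (auto simp: f_def T_def inj_on_def)
  also have "card T = (\<Sum>E\<in>Pow (I - J). card {A \<in> Pow J. card A \<in> S E})"
    unfolding T_def using assms finJ by (intro card_SigmaI) auto
  also have "\<dots> \<le> (\<Sum>E\<in>Pow (I - J). s * ((2 * m) choose m))"
    using card_subsets_with_size_in[OF finJ assms(3,4)] assms(5)
    by (intro sum_mono) (meson mult_le_mono1 order_trans)
  also have "\<dots> = 2 ^ (card I - 2 * m) * (s * ((2 * m) choose m))"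
    using assms finJ by (simp add: card_Pow card_Diff_subset)
  finally show ?thesis .
qed

text \<open>\<open>E\<close> is one outcome of all coins; fair coins correspond to uniform weights
  on \<open>Pow I\<close>.\<close>

definition select :: "'b set \<Rightarrow> ('b \<Rightarrow> 'c \<times> 'c) \<Rightarrow> 'b \<Rightarrow> 'c" where
  "select E \<omega> i = (if i \<in> E then snd (\<omega> i) else fst (\<omega> i))"

text \<open>The pairs are fixed and only the coins vary. Given the coins outside \<open>J\<close>, a
  bad selection forces the number of selected members near \<open>u\<close> into an exceptional set
  of size at most \<open>2 * k ^ 3\<close>; each number is attained by at most a central binomial
  coefficient of the coin patterns on \<open>J\<close>.\<close>

lemma few_bad_selections:
  fixes \<omega> :: "'b \<Rightarrow> complex \<times> complex" and u v :: complex
  assumes "finite I" "J \<subseteq> I" "card J = 2 * m" "k > 0" "u \<noteq> v" "r \<ge> 0"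
    and "2 * r * real (2 * m) / cmod (u - v) \<le> 1 / 12"
    and J: "\<And>i. i \<in> J \<Longrightarrow> \<omega> i \<in> cball u r \<times> cball v r \<union> cball v r \<times> cball u r"
  shows "real (card {E \<in> Pow I. cmod (coeff (\<Prod>i\<in>I. [:1, select E \<omega> i:]) k) < cmod (u - v) ^ k / 2})
    \<le> 2 ^ card I * (2 * real k ^ 3 / sqrt (2 * real m + 1))"
proof -
  have finJ: "finite J" using assms(1,2) by (rule finite_subset[rotated])
  \<comment> \<open>The exceptional set is made a function of \<open>E\<close> and later taken at
    \<open>E - J\<close>, so that the coins in \<open>J\<close> cannot influence it.\<close>
  have "\<exists>S::nat set. finite S \<and> card S \<le> 2 * k ^ 3 \<and> (\<forall>z A.
      (\<forall>i\<in>I - J. z i = select E \<omega> i) \<longrightarrow> A \<subseteq> J \<longrightarrow>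
      (\<forall>i\<in>A. cmod (z i - u) \<le> r) \<longrightarrow> (\<forall>i\<in>J - A. cmod (z i - v) \<le> r) \<longrightarrow>
      card A \<notin> S \<longrightarrow> cmod (coeff (\<Prod>i\<in>I. [:1, z i:]) k) \<ge> cmod (u - v) ^ k / 2)" for E
    by (rule exceptional_sizes[of I J k u v r "select E \<omega>"]) (use assms in auto)
  then obtain S :: "'b set \<Rightarrow> nat set" where S: "\<And>E. finite (S E)" "\<And>E. card (S E) \<le> 2 * k ^ 3"
    "\<And>E z A. (\<forall>i\<in>I - J. z i = select E \<omega> i) \<Longrightarrow> A \<subseteq> J \<Longrightarrow>
      (\<forall>i\<in>A. cmod (z i - u) \<le> r) \<Longrightarrow> (\<forall>i\<in>J - A. cmod (z i - v) \<le> r) \<Longrightarrow>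
      card A \<notin> S E \<Longrightarrow> cmod (coeff (\<Prod>i\<in>I. [:1, z i:]) k) \<ge> cmod (u - v) ^ k / 2"
    by metis
  define B where "B = {i \<in> J. \<omega> i \<in> cball u r \<times> cball v r}"
  have "card {i \<in> J. (i \<in> B) \<noteq> (i \<in> E)} \<in> S (E - J)"
    if "cmod (coeff (\<Prod>i\<in>I. [:1, select E \<omega> i:]) k) < cmod (u - v) ^ k / 2" for E
  proof (rule ccontr)
    assume "card {i \<in> J. (i \<in> B) \<noteq> (i \<in> E)} \<notin> S (E - J)"
    moreover have "\<forall>i\<in>I - J. select E \<omega> i = select (E - J) \<omega> i"
      by (auto simp: select_def)
    moreover have "\<forall>i\<in>{i \<in> J. (i \<in> B) \<noteq> (i \<in> E)}. cmod (select E \<omega> i - u) \<le> r"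
      using J by (force simp: select_def B_def dist_norm norm_minus_commute)
    moreover have "\<forall>i\<in>J - {i \<in> J. (i \<in> B) \<noteq> (i \<in> E)}. cmod (select E \<omega> i - v) \<le> r"
      using J by (force simp: select_def B_def dist_norm norm_minus_commute)
    ultimately have "cmod (u - v) ^ k / 2 \<le> cmod (coeff (\<Prod>i\<in>I. [:1, select E \<omega> i:]) k)"
      by (intro S(3)[of "select E \<omega>" "E - J" "{i \<in> J. (i \<in> B) \<noteq> (i \<in> E)}"]) auto
    with that show False by simp
  qed
  then have "card {E \<in> Pow I. cmod (coeff (\<Prod>i\<in>I. [:1, select E \<omega> i:]) k) < cmod (u - v) ^ k / 2}
    \<le> card {E \<in> Pow I. card {i \<in> J. (i \<in> B) \<noteq> (i \<in> E)} \<in> S (E - J)}"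
    using assms(1) by (intro card_mono) auto
  also have "\<dots> \<le> 2 ^ (card I - 2 * m) * (2 * k ^ 3 * ((2 * m) choose m))"
    by (rule card_swaps_with_size_in) (use assms S in auto)
  finally have "real (card {E \<in> Pow I. cmod (coeff (\<Prod>i\<in>I. [:1, select E \<omega> i:]) k) < cmod (u - v) ^ k / 2})
    \<le> real (2 ^ (card I - 2 * m) * (2 * k ^ 3 * ((2 * m) choose m)))"
    by (rule of_nat_mono)
  also have "\<dots> = 2 ^ (card I - 2 * m) * (2 * real k ^ 3 * real ((2 * m) choose m))" by simp
  also have "\<dots> \<le> 2 ^ (card I - 2 * m) * (2 * real k ^ 3 * (4 ^ m / sqrt (2 * real m + 1)))"
    using central_binomial_upper_bound[of m] by (intro mult_left_mono) auto
  also have "\<dots> = (2 ^ (card I - 2 * m) * 2 ^ (2 * m)) * (2 * real k ^ 3 / sqrt (2 * real m + 1))"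
    by (simp add: power_mult)
  also have "(2::real) ^ (card I - 2 * m) * 2 ^ (2 * m) = 2 ^ card I"
    using card_mono[OF assms(1,2)] assms(3) by (simp flip: power_add)
  finally show ?thesis .
qed

section \<open>Discs of large mass and product measures\<close>

text \<open>By Lindelof the union of all open null sets is null. Its complement is the support, and
  if that had at most one point the identity would be almost surely constant.\<close>

lemma two_support_points:
  fixes \<mu> :: "'a :: {metric_space, second_countable_topology} measure"
  assumes "finite_measure \<mu>" "sets \<mu> = sets borel" "\<not> (\<exists>c. AE x in \<mu>. x = c)"
  obtains u v where "u \<noteq> v" "\<And>r. r > 0 \<Longrightarrow> measure \<mu> (cball u r) > 0"
    "\<And>r. r > 0 \<Longrightarrow> measure \<mu> (cball v r) > 0"
proof -
  interpret finite_measure \<mu> by fact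
  note [measurable_cong] = assms(2)
  define F where "F = {B. open B \<and> emeasure \<mu> B = 0}"
  obtain F' where F': "F' \<subseteq> F" "countable F'" "\<Union>F' = \<Union>F"
    using Lindelof[of F] by (auto simp: F_def)
  have "AE x in \<mu>. x \<notin> B" if "B \<in> F'" for B
    using that F'(1) by (intro AE_not_in) (auto simp: F_def null_sets_def assms(2))
  then have "AE x in \<mu>. \<forall>B\<in>F'. x \<notin> B"
    using F'(2) by (simp add: AE_ball_countable)
  then have AE: "AE x in \<mu>. x \<notin> \<Union>F"
    unfolding F'(3)[symmetric] by simp
  have pos: "measure \<mu> (cball u r) > 0" if "u \<notin> \<Union>F" "r > 0" for u r
  proof -
    have "emeasure \<mu> (ball u r) \<noteq> 0" using that by (force simp: F_def)
    then have "0 < measure \<mu> (ball u r)"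
      by (simp add: emeasure_eq_measure zero_less_measure_iff)
    also have "\<dots> \<le> measure \<mu> (cball u r)"
      by (intro finite_measure_mono) (auto simp: assms(2))
    finally show ?thesis .
  qed
  have "\<exists>u v. u \<noteq> v \<and> u \<notin> \<Union>F \<and> v \<notin> \<Union>F"
  proof (rule ccontr)
    assume "\<not> ?thesis"
    then obtain c where "\<And>x. x \<notin> \<Union>F \<Longrightarrow> x = c" by metis
    then have "AE x in \<mu>. x = c" using AE by (auto elim: eventually_mono)
    then show False using assms(3) by blast
  qed
  then show ?thesis using that pos by blast
qed

text \<open>Pigeonhole over a grid of mesh \<open>\<rho> / K\<close>, whose small discs cover
  \<open>cball c \<rho>\<close>. The centre has to move because the mass of shrinking discs around a
  fixed support point can decay arbitrarily fast.\<close>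

lemma heavy_small_disc:
  fixes \<mu> :: "complex measure"
  assumes "finite_measure \<mu>" "sets \<mu> = sets borel" "\<rho> > 0" "K > 0"
  obtains u where "cmod (u - c) \<le> 2 * \<rho>"
    "measure \<mu> (cball u (2 * \<rho> / real K)) \<ge> measure \<mu> (cball c \<rho>) / (2 * real K + 1)\<^sup>2"
proof -
  interpret finite_measure \<mu> by fact
  define P where "P = {- int K..int K} \<times> {- int K..int K}"
  define g where "g = (\<lambda>(a, b). c + of_real (\<rho> / real K) * Complex (of_int a) (of_int b))"
  have cardP: "card P = (2 * K + 1)\<^sup>2"
  proof -
    have "card {- int K..int K} = 2 * K + 1" by (simp add: nat_add_distrib nat_mult_distrib)
    then show ?thesis by (simp only: P_def card_cartesian_product power2_eq_square)
  qed
  have small: "cmod (Complex x y) \<le> \<bar>x\<bar> + \<bar>y\<bar>" for x y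
    using cmod_le[of "Complex x y"] by simp
  have "cball c \<rho> \<subseteq> (\<Union>p\<in>P. cball (g p) (2 * \<rho> / real K))"
  proof
    fix z assume z: "z \<in> cball c \<rho>"
    \<comment> \<open>Rescaling turns the mesh into 1; taking floors of both coordinates gives the
      grid point, with error at most 2.\<close>
    define d where "d = of_real (real K / \<rho>) * (z - c)"
    have zd: "z = c + of_real (\<rho> / real K) * d"
      using assms by (simp add: d_def)
    have "cmod d = real K / \<rho> * cmod (z - c)"
      using assms by (simp add: d_def norm_mult norm_divide)
    also have "\<dots> \<le> real K / \<rho> * \<rho>"
      using z assms by (intro mult_left_mono) (auto simp: dist_norm norm_minus_commute)
    finally have d: "cmod d \<le> real K" using assms by simp
    have "\<bar>Re d\<bar> \<le> real K" "\<bar>Im d\<bar> \<le> real K"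
      using abs_Re_le_cmod[of d] abs_Im_le_cmod[of d] d by linarith+
    then have P: "(\<lfloor>Re d\<rfloor>, \<lfloor>Im d\<rfloor>) \<in> P" unfolding P_def by (auto; linarith)
    have "z - g (\<lfloor>Re d\<rfloor>, \<lfloor>Im d\<rfloor>) = of_real (\<rho> / real K) * Complex (Re d - \<lfloor>Re d\<rfloor>) (Im d - \<lfloor>Im d\<rfloor>)"
      by (subst zd) (simp add: g_def complex_eq_iff algebra_simps diff_divide_distrib)
    then have "cmod (z - g (\<lfloor>Re d\<rfloor>, \<lfloor>Im d\<rfloor>)) = \<rho> / real K * cmod (Complex (Re d - \<lfloor>Re d\<rfloor>) (Im d - \<lfloor>Im d\<rfloor>))"
      using assms by (simp add: norm_mult norm_divide)
    also have "\<dots> \<le> \<rho> / real K * 2"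
      using assms by (intro mult_left_mono order_trans[OF small]) (auto, linarith)
    finally show "z \<in> (\<Union>p\<in>P. cball (g p) (2 * \<rho> / real K))"
      using P by (auto simp: dist_norm norm_minus_commute mult_ac intro!: bexI[of _ "(\<lfloor>Re d\<rfloor>, \<lfloor>Im d\<rfloor>)"])
  qed
  then have "measure \<mu> (cball c \<rho>) \<le> measure \<mu> (\<Union>p\<in>P. cball (g p) (2 * \<rho> / real K))"
    by (intro finite_measure_mono) (auto simp: assms(2) P_def)
  also have "\<dots> \<le> (\<Sum>p\<in>P. measure \<mu> (cball (g p) (2 * \<rho> / real K)))"
    by (intro measure_UNION_le) (auto simp: assms(2) P_def)
  finally have sum: "measure \<mu> (cball c \<rho>) \<le> \<dots>" .
  have "\<exists>p\<in>P. measure \<mu> (cball (g p) (2 * \<rho> / real K)) \<ge> measure \<mu> (cball c \<rho>) / (2 * real K + 1)\<^sup>2"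
  proof (rule ccontr)
    assume "\<not> ?thesis"
    then have "(\<Sum>p\<in>P. measure \<mu> (cball (g p) (2 * \<rho> / real K)))
        < (\<Sum>p\<in>P. measure \<mu> (cball c \<rho>) / (2 * real K + 1)\<^sup>2)"
      by (intro sum_strict_mono) (auto simp: not_le P_def)
    also have "\<dots> = measure \<mu> (cball c \<rho>)"
      by (simp add: cardP add.commute)
    finally show False using sum by simp
  qed
  then obtain a b where ab: "(a, b) \<in> P"
    "measure \<mu> (cball (g (a, b)) (2 * \<rho> / real K)) \<ge> measure \<mu> (cball c \<rho>) / (2 * real K + 1)\<^sup>2"
    by auto
  have "cmod (g (a, b) - c) = \<rho> / real K * cmod (Complex (of_int a) (of_int b))"
    using assms by (simp add: g_def norm_mult norm_divide)
  also have "\<dots> \<le> \<rho> / real K * (2 * real K)"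
    using assms ab(1) by (intro mult_left_mono order_trans[OF small]) (auto simp: P_def)
  finally have "cmod (g (a, b) - c) \<le> 2 * \<rho>" using assms by simp
  with ab(2) show ?thesis using that by blast
qed

section \<open>Averaging, independence and concentration\<close>

text \<open>Double counting: \<open>p\<close> is the expected proportion of those \<open>E\<close>
  whose event occurs. This proportion is at most \<open>b\<close> on \<open>G\<close> and at most 1
  elsewhere.\<close>

lemma (in prob_space) prob_le_by_averaging:
  assumes "finite \<E>" "\<E> \<noteq> {}" and A: "\<And>E. E \<in> \<E> \<Longrightarrow> A E \<in> events" "\<And>E. E \<in> \<E> \<Longrightarrow> prob (A E) = p"
    and G: "G \<in> events" "\<And>\<omega>. \<omega> \<in> G \<Longrightarrow> real (card {E \<in> \<E>. \<omega> \<in> A E}) \<le> real (card \<E>) * b" and "b \<ge> 0"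
  shows "p \<le> prob (space M - G) + b"
proof -
  have c: "real (card \<E>) > 0" using assms by (simp add: card_gt_0_iff)
  have "real (card \<E>) * p = (\<Sum>E\<in>\<E>. prob (A E))" using A by simp
  also have "\<dots> = (\<Sum>E\<in>\<E>. expectation (indicator (A E)))" using A by simp
  also have "\<dots> = expectation (\<lambda>\<omega>. \<Sum>E\<in>\<E>. indicator (A E) \<omega>)"
    using A by (subst Bochner_Integration.integral_sum) (auto simp: emeasure_eq_measure)
  also have "\<dots> \<le> expectation (\<lambda>\<omega>. real (card \<E>) * (indicator (space M - G) \<omega> + b))"
  proof (rule integral_mono)
    fix \<omega> assume \<omega>: "\<omega> \<in> space M"
    have eq: "(\<Sum>E\<in>\<E>. indicator (A E) \<omega>) = real (card {E \<in> \<E>. \<omega> \<in> A E})"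
      using assms(1) by (simp add: indicator_def sum.If_cases Int_def)
    also have "\<dots> \<le> real (card \<E>) * (indicator (space M - G) \<omega> + b)"
    proof (cases "\<omega> \<in> G")
      case False
      have "real (card {E \<in> \<E>. \<omega> \<in> A E}) \<le> real (card \<E>) * 1"
        using assms(1) by (auto intro: card_mono)
      also have "\<dots> \<le> real (card \<E>) * (indicator (space M - G) \<omega> + b)"
        using False \<omega> \<open>b \<ge> 0\<close> by (intro mult_left_mono) auto
      finally show ?thesis .
    qed (use G(2) in auto)
    finally show "(\<Sum>E\<in>\<E>. indicator (A E) \<omega>) \<le> real (card \<E>) * (indicator (space M - G) \<omega> + b)" .
  qed (use A G(1) in \<open>auto simp: emeasure_eq_measure intro!: Bochner_Integration.integrable_sum\<close>)
  also have "\<dots> = real (card \<E>) * (prob (space M - G) + b)"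
    using G(1) by (simp add: prob_space emeasure_eq_measure)
  finally show ?thesis using c by simp
qed

lemma indep_vars_PiM_components:
  assumes "\<And>i. i \<in> I \<Longrightarrow> prob_space (M i)" "I \<noteq> {}"
  shows "prob_space.indep_vars (PiM I M) M (\<lambda>i \<omega>. \<omega> i) I"
proof -
  interpret prob_space "PiM I M" using assms by (intro prob_space_PiM) auto
  have "distr (PiM I M) (PiM I M) (\<lambda>\<omega>. \<lambda>i\<in>I. \<omega> i) = distr (PiM I M) (PiM I M) (\<lambda>\<omega>. \<omega>)"
    by (intro distr_cong) (auto simp: space_PiM)
  also have "\<dots> = (\<Pi>\<^sub>M i\<in>I. distr (PiM I M) (M i) (\<lambda>\<omega>. \<omega> i))"
    using assms by (simp add: distr_id2) (intro PiM_cong refl, simp add: distr_PiM_component)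
  finally show ?thesis
    using assms by (subst indep_vars_iff_distr_eq_PiM') auto
qed

text \<open>For fixed \<open>E\<close> each selected member depends on its own pair only and has law
  \<open>\<mu>\<close>, so independence of the pairs carries over.\<close>

lemma distr_select:
  fixes \<mu> :: "'a measure"
  assumes "prob_space \<mu>" "I \<noteq> {}"
  shows "distr (\<Pi>\<^sub>M i\<in>I. \<mu> \<Otimes>\<^sub>M \<mu>) (\<Pi>\<^sub>M i\<in>I. \<mu>) (\<lambda>\<omega>. \<lambda>i\<in>I. select E \<omega> i) = (\<Pi>\<^sub>M i\<in>I. \<mu>)"
proof -
  interpret \<mu>: prob_space \<mu> by fact
  interpret \<mu>2: pair_prob_space \<mu> \<mu> ..
  have snd: "distr (\<mu> \<Otimes>\<^sub>M \<mu>) \<mu> snd = \<mu>"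
  proof (rule measure_eqI)
    fix A assume "A \<in> sets (distr (\<mu> \<Otimes>\<^sub>M \<mu>) \<mu> snd)"
    then have A: "A \<in> sets \<mu>" by simp
    then have "snd -` A \<inter> space (\<mu> \<Otimes>\<^sub>M \<mu>) = space \<mu> \<times> A"
      using sets.sets_into_space by (fastforce simp: space_pair_measure)
    then show "emeasure (distr (\<mu> \<Otimes>\<^sub>M \<mu>) \<mu> snd) A = emeasure \<mu> A"
      using A by (simp add: emeasure_distr \<mu>.emeasure_pair_measure_Times \<mu>.emeasure_space_1)
  qed simp
  interpret P: prob_space "\<Pi>\<^sub>M i\<in>I. \<mu> \<Otimes>\<^sub>M \<mu>"
    by (intro prob_space_PiM \<mu>2.prob_space_axioms)
  define f where "f i = (if i \<in> E then snd else fst :: 'a \<times> 'a \<Rightarrow> 'a)" for i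
  have f[measurable]: "f i \<in> \<mu> \<Otimes>\<^sub>M \<mu> \<rightarrow>\<^sub>M \<mu>" for i by (simp add: f_def)
  have sel: "select E \<omega> i = f i (\<omega> i)" for \<omega> i by (simp add: f_def select_def)
  have df: "distr (\<mu> \<Otimes>\<^sub>M \<mu>) \<mu> (f i) = \<mu>" for i
    by (simp add: f_def \<mu>.distr_pair_fst snd)
  have "P.indep_vars (\<lambda>_. \<mu>) (\<lambda>i \<omega>. f i (\<omega> i)) I"
    by (rule P.indep_vars_compose2[OF indep_vars_PiM_components])
       (use assms \<mu>2.prob_space_axioms in auto)
  then have "distr (\<Pi>\<^sub>M i\<in>I. \<mu> \<Otimes>\<^sub>M \<mu>) (\<Pi>\<^sub>M i\<in>I. \<mu>) (\<lambda>\<omega>. \<lambda>i\<in>I. f i (\<omega> i))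
    = (\<Pi>\<^sub>M i\<in>I. distr (\<Pi>\<^sub>M i\<in>I. \<mu> \<Otimes>\<^sub>M \<mu>) \<mu> (\<lambda>\<omega>. f i (\<omega> i)))"
    using assms by (subst (asm) P.indep_vars_iff_distr_eq_PiM') auto
  also have "\<dots> = (\<Pi>\<^sub>M i\<in>I. \<mu>)"
  proof (rule PiM_cong[OF refl])
    fix i assume i: "i \<in> I"
    have "distr (\<Pi>\<^sub>M i\<in>I. \<mu> \<Otimes>\<^sub>M \<mu>) \<mu> (\<lambda>\<omega>. f i (\<omega> i))
      = distr (distr (\<Pi>\<^sub>M i\<in>I. \<mu> \<Otimes>\<^sub>M \<mu>) (\<mu> \<Otimes>\<^sub>M \<mu>) (\<lambda>\<omega>. \<omega> i)) \<mu> (f i)"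
      using i by (subst distr_distr) (auto simp: o_def)
    also have "\<dots> = \<mu>"
      using distr_PiM_component[of I "\<lambda>_. \<mu> \<Otimes>\<^sub>M \<mu>" i] i df \<mu>2.prob_space_axioms by simp
    finally show "distr (\<Pi>\<^sub>M i\<in>I. \<mu> \<Otimes>\<^sub>M \<mu>) \<mu> (\<lambda>\<omega>. f i (\<omega> i)) = \<mu>" .
  qed
  finally show ?thesis by (simp add: sel)
qed

text \<open>Hoeffding's inequality for the sum of the indicators of \<open>D\<close>, with a
  deviation of half the mean.\<close>

lemma few_visits_unlikely:
  assumes "prob_space \<nu>" "finite I" "I \<noteq> {}" "D \<in> sets \<nu>"
  shows "measure (\<Pi>\<^sub>M i\<in>I. \<nu>) {\<omega> \<in> space (\<Pi>\<^sub>M i\<in>I. \<nu>).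
      real (card {i \<in> I. \<omega> i \<in> D}) \<le> real (card I) * measure \<nu> D / 2}
    \<le> exp (- (real (card I) * (measure \<nu> D)\<^sup>2 / 2))"
proof -
  interpret \<nu>: prob_space \<nu> by fact
  interpret P: prob_space "\<Pi>\<^sub>M i\<in>I. \<nu>" by (intro prob_space_PiM \<nu>.prob_space_axioms)
  define q where "q = measure \<nu> D"
  define X :: "'b \<Rightarrow> ('b \<Rightarrow> 'a) \<Rightarrow> real" where "X i \<omega> = indicator D (\<omega> i)" for i \<omega>
  have ex: "P.expectation (X i) = q" if "i \<in> I" for i
  proof -
    have "P.expectation (X i) = integral\<^sup>L (distr (\<Pi>\<^sub>M i\<in>I. \<nu>) \<nu> (\<lambda>\<omega>. \<omega> i)) (indicator D)"
      unfolding X_def using that assms by (subst integral_distr) auto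
    also have "\<dots> = q"
      using distr_PiM_component[of I "\<lambda>_. \<nu>" i] that assms by (simp add: q_def)
    finally show ?thesis .
  qed
  interpret Hoeffding_ineq "\<Pi>\<^sub>M i\<in>I. \<nu>" I X "\<lambda>_. 0" "\<lambda>_. 1" "\<Sum>i\<in>I. P.expectation (X i)"
  proof (unfold_locales)
    show "P.indep_vars (\<lambda>_. borel) X I" unfolding X_def
      by (rule P.indep_vars_compose2[OF indep_vars_PiM_components, where Y = "\<lambda>_. indicator D"])
         (use assms in auto)
  qed (use assms in \<open>auto simp: X_def indicator_def\<close>)
  have n: "real (card I) > 0" using assms by (simp add: card_gt_0_iff)
  have "{\<omega> \<in> space (\<Pi>\<^sub>M i\<in>I. \<nu>). real (card {i \<in> I. \<omega> i \<in> D}) \<le> real (card I) * q / 2} =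
    {\<omega> \<in> space (\<Pi>\<^sub>M i\<in>I. \<nu>). (\<Sum>i\<in>I. X i \<omega>) \<le> (\<Sum>i\<in>I. P.expectation (X i)) - real (card I) * q / 2}"
  proof -
    have "(\<Sum>i\<in>I. X i \<omega>) = real (card {i \<in> I. \<omega> i \<in> D})" for \<omega>
      using assms by (simp add: X_def indicator_def sum.If_cases Int_def)
    then show ?thesis by (simp add: ex mult.commute)
  qed
  also have "P.prob \<dots> \<le> exp (- 2 * (real (card I) * q / 2)\<^sup>2 / (\<Sum>i\<in>I. (1 - 0)\<^sup>2))"
    by (rule Hoeffding_ineq_le) (use n in \<open>auto simp: q_def\<close>)
  also have "\<dots> = exp (- (real (card I) * q\<^sup>2 / 2))"
    using n by (simp add: power2_eq_square field_simps)
  finally show ?thesis unfolding q_def .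
qed

section \<open>Small ball probabilities\<close>

lemma elem_sym_restrict: "elem_sym k n (restrict y {1..n}) = elem_sym k n y"
  unfolding elem_sym_eq_coeff by (intro arg_cong2[where f = coeff] prod.cong) auto

lemma elem_sym_measurable:
  assumes "sets \<mu> = sets borel"
  shows "elem_sym k n \<in> borel_measurable (\<Pi>\<^sub>M i\<in>{1..n}. \<mu>)"
  unfolding elem_sym_eq_sum_subsets
proof (intro borel_measurable_sum borel_measurable_prod)
  fix S i assume "S \<in> {S. S \<subseteq> {1..n} \<and> card S = k}" "i \<in> S"
  then have "(\<lambda>y. y i) \<in> (\<Pi>\<^sub>M i\<in>{1..n}. \<mu>) \<rightarrow>\<^sub>M \<mu>"
    by (intro measurable_component_singleton) auto
  then show "(\<lambda>y. y i) \<in> borel_measurable (\<Pi>\<^sub>M i\<in>{1..n}. \<mu>)"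
    by (simp add: measurable_cong_sets[OF refl assms])
qed

text \<open>Realise the variables as selections from independent pairs; each fixed \<open>E\<close>
  gives the same probability, so averaging over \<open>E\<close> is allowed. The exponential term
  bounds the event that few pairs have one member in each disc. On its complement at least
  \<open>2 * m\<close> pairs do, and \<open>few_bad_selections\<close> yields the other
  term.\<close>

lemma elem_sym_small_ball:
  fixes \<mu> :: "complex measure" and u v :: complex
  assumes "prob_space \<mu>" and sets_\<mu>: "sets \<mu> = sets borel"
    and "n > 0" "k > 0" "u \<noteq> v" "r \<ge> 0" "2 * r * real (2 * m) / cmod (u - v) \<le> 1 / 12"
    and q: "0 \<le> q" "q \<le> measure \<mu> (cball u r) * measure \<mu> (cball v r)"
    and m: "real (2 * m) \<le> real n * q / 2"
  shows "measure (\<Pi>\<^sub>M i\<in>{1..n}. \<mu>)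
      {y \<in> space (\<Pi>\<^sub>M i\<in>{1..n}. \<mu>). cmod (elem_sym k n y) < cmod (u - v) ^ k / 2}
    \<le> exp (- (real n * q\<^sup>2 / 2)) + 2 * real k ^ 3 / sqrt (2 * real m + 1)"
    (is "measure ?P ?B \<le> _")
proof -
  interpret \<mu>: prob_space \<mu> by fact
  interpret \<mu>2: pair_prob_space \<mu> \<mu> ..
  define \<nu> where "\<nu> = \<mu> \<Otimes>\<^sub>M \<mu>"
  have \<nu>: "prob_space \<nu>" unfolding \<nu>_def by (rule \<mu>2.prob_space_axioms)
  define I where "I = {1..n}"
  have I: "finite I" "I \<noteq> {}" "card I = n" using assms by (auto simp: I_def)
  define P where "P = (\<Pi>\<^sub>M i\<in>I. \<nu>)"
  interpret P: prob_space P unfolding P_def by (intro prob_space_PiM \<nu>)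
  define D where "D = cball u r \<times> cball v r \<union> cball v r \<times> cball u r"
  have rect: "cball a r \<times> cball b r \<in> sets \<nu>" for a b
    unfolding \<nu>_def by (intro pair_measureI) (auto simp: sets_\<mu>)
  have D: "D \<in> sets \<nu>" unfolding D_def by (intro sets.Un rect)
  have "q \<le> measure \<nu> (cball u r \<times> cball v r)"
    using q(2) by (simp add: \<nu>_def measure_def \<mu>.emeasure_pair_measure_Times sets_\<mu> enn2real_mult)
  also have "\<dots> \<le> measure \<nu> D"
    unfolding \<nu>_def by (rule \<mu>2.finite_measure_mono) (use D in \<open>auto simp: D_def \<nu>_def\<close>)
  finally have qD: "q \<le> measure \<nu> D" .
  define p where "p = measure ?P ?B"
  define t where "t = cmod (u - v) ^ k / 2"
  define A where "A E = {\<omega> \<in> space P. cmod (elem_sym k n (select E \<omega>)) < t}" for E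
  have meas[measurable]: "elem_sym k n \<in> borel_measurable ?P"
    by (rule elem_sym_measurable[OF sets_\<mu>])
  have B: "?B \<in> sets ?P" by measurable
  have sel: "(\<lambda>\<omega>. \<lambda>i\<in>I. select E \<omega> i) \<in> P \<rightarrow>\<^sub>M ?P" for E
    unfolding I_def[symmetric] P_def \<nu>_def select_def by measurable
  have A_eq: "A E = (\<lambda>\<omega>. \<lambda>i\<in>I. select E \<omega> i) -` ?B \<inter> space P" for E
    using measurable_space[OF sel] by (auto simp: A_def t_def I_def elem_sym_restrict simp del: One_nat_def)
  have A: "A E \<in> P.events" for E unfolding A_eq using sel B by (rule measurable_sets)
  have pA: "P.prob (A E) = p" for E
  proof -
    have "P.prob (A E) = measure (distr P ?P (\<lambda>\<omega>. \<lambda>i\<in>I. select E \<omega> i)) ?B"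
      unfolding A_eq by (rule measure_distr[symmetric]) (use sel B in auto)
    also have "\<dots> = p"
      using distr_select[OF assms(1) I(2)] by (simp add: P_def \<nu>_def I_def p_def)
    finally show ?thesis .
  qed
  define few where "few = {\<omega> \<in> space P. real (card {i \<in> I. \<omega> i \<in> D}) \<le> real (card I) * measure \<nu> D / 2}"
  have few_meas: "few \<in> P.events"
  proof -
    have "(\<lambda>\<omega>. \<Sum>i\<in>I. indicator D (\<omega> i) :: real) \<in> borel_measurable P"
      unfolding P_def using D by measurable
    moreover have "(\<Sum>i\<in>I. indicator D (\<omega> i)) = real (card {i \<in> I. \<omega> i \<in> D})" for \<omega>
      using I by (simp add: indicator_def sum.If_cases Int_def)
    ultimately have "(\<lambda>\<omega>. real (card {i \<in> I. \<omega> i \<in> D})) \<in> borel_measurable P" by simp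
    then show ?thesis unfolding few_def by measurable
  qed
  have few: "P.prob few \<le> exp (- (real n * q\<^sup>2 / 2))"
  proof -
    have "P.prob few \<le> exp (- (real n * (measure \<nu> D)\<^sup>2 / 2))"
      using few_visits_unlikely[OF \<nu> I(1,2) D] by (simp add: few_def P_def I(3))
    also have "\<dots> \<le> exp (- (real n * q\<^sup>2 / 2))"
      using q(1) qD by (auto intro!: mult_left_mono power_mono)
    finally show ?thesis .
  qed
  have "p \<le> P.prob (space P - (space P - few)) + 2 * real k ^ 3 / sqrt (2 * real m + 1)"
  proof (rule P.prob_le_by_averaging[of "Pow I" A])
    fix \<omega> assume \<omega>: "\<omega> \<in> space P - few"
    then have "real n * measure \<nu> D / 2 < real (card {i \<in> I. \<omega> i \<in> D})"
      using I by (auto simp: few_def)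
    moreover have "real n * q / 2 \<le> real n * measure \<nu> D / 2"
      using qD by (intro divide_right_mono mult_left_mono) auto
    ultimately have "2 * m \<le> card {i \<in> I. \<omega> i \<in> D}"
      using m by linarith
    then obtain J where J: "J \<subseteq> {i \<in> I. \<omega> i \<in> D}" "card J = 2 * m"
      using obtain_subset_with_card_n by metis
    from J have JI: "J \<subseteq> I" and JD: "\<And>i. i \<in> J \<Longrightarrow> \<omega> i \<in> cball u r \<times> cball v r \<union> cball v r \<times> cball u r"
      unfolding D_def by blast+
    have "{E \<in> Pow I. \<omega> \<in> A E} = {E \<in> Pow I. cmod (coeff (\<Prod>i\<in>I. [:1, select E \<omega> i:]) k) < cmod (u - v) ^ k / 2}"
      using \<omega> by (auto simp: A_def t_def elem_sym_eq_coeff I_def)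
    then show "real (card {E \<in> Pow I. \<omega> \<in> A E}) \<le> real (card (Pow I)) * (2 * real k ^ 3 / sqrt (2 * real m + 1))"
      using few_bad_selections[OF I(1) JI J(2) assms(4-7) JD] I(1) by (simp add: card_Pow)
  qed (use I A pA few_meas in auto)
  moreover have "space P - (space P - few) = few" by (auto simp: few_def)
  ultimately show ?thesis using few unfolding p_def by simp
qed

section \<open>Transfer to i.i.d. copies and passage to the limit\<close>

lemma iid_joint_law:
  assumes "prob_space M" "iid_copies M Y N X" "n > 0"
  shows "distr M (\<Pi>\<^sub>M i\<in>{1..n}. distr N borel X) (\<lambda>\<omega>. \<lambda>i\<in>{1..n}. Y i \<omega>)
    = (\<Pi>\<^sub>M i\<in>{1..n}. distr N borel X)"
proof -
  interpret prob_space M by fact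
  have ind: "indep_vars (\<lambda>_. borel) Y {1..n}"
    using assms(2) by (auto simp: iid_copies_def intro: indep_vars_subset)
  then have rv: "\<And>i. i \<in> {1..n} \<Longrightarrow> random_variable borel (Y i)"
    by (auto simp: indep_vars_def)
  have "distr M (\<Pi>\<^sub>M i\<in>{1..n}. distr N borel X) (\<lambda>\<omega>. \<lambda>i\<in>{1..n}. Y i \<omega>)
    = distr M (\<Pi>\<^sub>M i\<in>{1..n}. borel) (\<lambda>\<omega>. \<lambda>i\<in>{1..n}. Y i \<omega>)"
    by (intro distr_cong refl sets_PiM_cong) auto
  also have "\<dots> = (\<Pi>\<^sub>M i\<in>{1..n}. distr M borel (Y i))"
    using ind assms(3) by (subst (asm) indep_vars_iff_distr_eq_PiM') (use rv in auto)
  also have "\<dots> = (\<Pi>\<^sub>M i\<in>{1..n}. distr N borel X)"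
    using assms(2) by (intro PiM_cong refl) (auto simp: iid_copies_def)
  finally show ?thesis .
qed

theorem lemma1p2:
  fixes M :: "'a measure" and Y :: "nat \<Rightarrow> 'a \<Rightarrow> complex"
    and N :: "'b measure" and X :: "'b \<Rightarrow> complex"
    and k :: "nat \<Rightarrow> nat" and \<epsilon> :: real
  assumes "prob_space M"
    and "prob_space N"
    and "X \<in> borel_measurable N"
    and "nondegenerate N X"
    and "iid_copies M Y N X"
    and "\<forall>n\<ge>1. k n > 0"
    and "\<forall>\<^sub>F n in sequentially. 1 \<le> k n \<and> real (k n) \<le> ln (real n) / (5 * ln (ln (real n)))"
    and "\<epsilon> > 0"
  shows "(\<lambda>n. measure M {\<omega> \<in> space M.
            cmod (elem_sym (k n) n (\<lambda>i. Y i \<omega>)) \<le> exp (- \<epsilon> * real n)}) \<longlonglongrightarrow> 0"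
proof -
  interpret M: prob_space M by fact
  interpret N: prob_space N by fact
  define \<mu> where "\<mu> = distr N borel X"
  interpret \<mu>: prob_space \<mu> unfolding \<mu>_def using assms(3) by (rule N.prob_space_distr)
  have sets_\<mu>: "sets \<mu> = sets borel" by (simp add: \<mu>_def)
  have "(AE x in \<mu>. x = c) \<longleftrightarrow> (AE \<omega> in N. X \<omega> = c)" for c
    unfolding \<mu>_def using assms(3) by (intro AE_distr_iff) auto
  then have "\<not> (\<exists>c. AE x in \<mu>. x = c)"
    using assms(4) by (simp add: nondegenerate_def)
  then obtain a b where ab: "a \<noteq> b" "\<And>r. r > 0 \<Longrightarrow> measure \<mu> (cball a r) > 0"
    "\<And>r. r > 0 \<Longrightarrow> measure \<mu> (cball b r) > 0"
    using two_support_points[OF \<mu>.finite_measure_axioms sets_\<mu>] by blast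
  \<comment> \<open>The points at distance \<open>8 * \<rho>\<close> will each be moved by at most
    \<open>2 * \<rho>\<close>, which leaves a distance of at least
    \<open>4 * \<rho>\<close>.\<close>
  define \<rho> where "\<rho> = cmod (a - b) / 8"
  have \<rho>: "\<rho> > 0" using ab by (simp add: \<rho>_def)
  define c where "c = min (measure \<mu> (cball a \<rho>)) (measure \<mu> (cball b \<rho>))"
  have c: "c > 0" using ab \<rho> by (simp add: c_def)
  \<comment> \<open>Each disc will have mass at least \<open>c / (49 * m)^2\<close>, where 49 comes
    from \<open>2 * K + 1 \<le> 49 * m\<close> with \<open>K = 24 * m\<close>;
    \<open>c1 / m ^ 4\<close> is the product of two such bounds.\<close>
  define c1 where "c1 = c\<^sup>2 / 49 ^ 4"
  have c1: "c1 > 0" using c by (simp add: c1_def)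
  \<comment> \<open>Chosen so that \<open>exp (- L)\<close> is at most \<open>4 * \<rho>\<close>;
    the minimum with 1 makes \<open>L\<close> nonnegative, so an upper bound on \<open>k n\<close>
    gives a lower bound on \<open>exp (- L * k n)\<close>.\<close>
  define L where "L = - ln (min 1 (4 * \<rho>))"
  \<comment> \<open>With \<open>q\<close> of order \<open>m ^ -4\<close>, this exponent makes
    \<open>n * q^2\<close> grow like \<open>n powr (1/5)\<close> and keeps \<open>m ^ 5\<close> far
    below \<open>n\<close>, while a power of \<open>ln n\<close> divided by \<open>sqrt m\<close>
    still tends to 0.\<close>
  define m where "m n = nat \<lfloor>real n powr (1 / 10)\<rfloor>" for n
  define p where "p n = measure M {\<omega> \<in> space M. cmod (elem_sym (k n) n (\<lambda>i. Y i \<omega>)) \<le> exp (- \<epsilon> * real n)}" for n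
  have bound: "p n \<le> exp (- (real n * (c1 / real (m n) ^ 4)\<^sup>2 / 2)) +
        2 * real (k n) ^ 3 / sqrt (2 * real (m n) + 1)"
    if n: "n > 0" "m n > 0" "4 * real (m n) ^ 5 \<le> c1 * real n"
      and eps: "exp (- \<epsilon> * real n) < (4 * \<rho>) ^ k n / 2" for n
  proof -
    \<comment> \<open>This makes \<open>r = \<rho> / (12 * m)\<close>, exactly what the tolerance
      1/12 requires when \<open>u\<close> and \<open>v\<close> are \<open>4 * \<rho>\<close>
      apart.\<close>
    define K where "K = 24 * m n"
    define r where "r = 2 * \<rho> / real K"
    have K: "K > 0" using n by (simp add: K_def)
    have disc: "\<exists>u. cmod (u - z) \<le> 2 * \<rho> \<and> measure \<mu> (cball u r) \<ge> c / (49 * real (m n))\<^sup>2"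
      if z: "z = a \<or> z = b" for z
    proof -
      obtain u where u: "cmod (u - z) \<le> 2 * \<rho>"
        "measure \<mu> (cball u r) \<ge> measure \<mu> (cball z \<rho>) / (2 * real K + 1)\<^sup>2"
        using heavy_small_disc[OF \<mu>.finite_measure_axioms sets_\<mu> \<rho> K] unfolding r_def by metis
      have "c / (49 * real (m n))\<^sup>2 \<le> measure \<mu> (cball z \<rho>) / (2 * real K + 1)\<^sup>2"
        using z n c by (intro frac_le power_mono) (auto simp: c_def K_def)
      with u show ?thesis by fastforce
    qed
    obtain u v where u: "cmod (u - a) \<le> 2 * \<rho>" "measure \<mu> (cball u r) \<ge> c / (49 * real (m n))\<^sup>2"
      and v: "cmod (v - b) \<le> 2 * \<rho>" "measure \<mu> (cball v r) \<ge> c / (49 * real (m n))\<^sup>2"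
      using disc by blast
    have "cmod (a - b) \<le> cmod (u - v) + cmod (u - a) + cmod (v - b)" by norm
    then have uv: "4 * \<rho> \<le> cmod (u - v)" using u v by (simp add: \<rho>_def)
    define q where "q = c1 / real (m n) ^ 4"
    have q0: "0 \<le> q" using c1 by (simp add: q_def)
    have "q = c / (49 * real (m n))\<^sup>2 * (c / (49 * real (m n))\<^sup>2)"
      by (simp add: q_def c1_def power2_eq_square power4_eq_xxxx)
    also have "\<dots> \<le> measure \<mu> (cball u r) * measure \<mu> (cball v r)"
      using u v c by (intro mult_mono) auto
    finally have q: "q \<le> measure \<mu> (cball u r) * measure \<mu> (cball v r)" .
    have "real (2 * m n) \<le> real n * q / 2"
      using n by (simp add: q_def field_simps power4_eq_xxxx numeral_eq_Suc)
    moreover have "2 * r * real (2 * m n) / cmod (u - v) \<le> 1 / 12"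
    proof -
      have "2 * r * real (2 * m n) / cmod (u - v) \<le> 2 * r * real (2 * m n) / (4 * \<rho>)"
        using uv \<rho> by (intro divide_left_mono mult_pos_pos) (auto simp: r_def intro: less_le_trans)
      also have "\<dots> = 1 / 12" using \<rho> n by (simp add: r_def K_def)
      finally show ?thesis .
    qed
    ultimately have main: "measure (\<Pi>\<^sub>M i\<in>{1..n}. \<mu>)
        {y \<in> space (\<Pi>\<^sub>M i\<in>{1..n}. \<mu>). cmod (elem_sym (k n) n y) < cmod (u - v) ^ k n / 2}
      \<le> exp (- (real n * q\<^sup>2 / 2)) + 2 * real (k n) ^ 3 / sqrt (2 * real (m n) + 1)" (is "measure ?P ?B \<le> _")
      using uv \<rho> n assms(6) q q0
      by (intro elem_sym_small_ball[where r = r] \<mu>.prob_space_axioms sets_\<mu>) (auto simp: r_def)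
    have [measurable]: "elem_sym (k n) n \<in> borel_measurable ?P"
      by (rule elem_sym_measurable[OF sets_\<mu>])
    have B: "?B \<in> sets ?P" by measurable
    have Ym: "Y i \<in> M \<rightarrow>\<^sub>M \<mu>" if "i \<in> {1..n}" for i
      using assms(5) that by (auto simp: iid_copies_def M.indep_vars_def \<mu>_def)
    have R: "(\<lambda>\<omega>. \<lambda>i\<in>{1..n}. Y i \<omega>) \<in> M \<rightarrow>\<^sub>M ?P"
      by (rule measurable_restrict) (use Ym in auto)
    have "exp (- \<epsilon> * real n) < cmod (u - v) ^ k n / 2"
      using eps power_mono[OF uv, of "k n"] \<rho> by simp
    then have "{\<omega> \<in> space M. cmod (elem_sym (k n) n (\<lambda>i. Y i \<omega>)) \<le> exp (- \<epsilon> * real n)}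
      \<subseteq> (\<lambda>\<omega>. \<lambda>i\<in>{1..n}. Y i \<omega>) -` ?B \<inter> space M"
      using measurable_space[OF R] by (auto simp: elem_sym_restrict simp del: One_nat_def)
    then have "p n \<le> M.prob ((\<lambda>\<omega>. \<lambda>i\<in>{1..n}. Y i \<omega>) -` ?B \<inter> space M)"
      unfolding p_def using R B by (intro M.finite_measure_mono) auto
    also have "\<dots> = measure (distr M ?P (\<lambda>\<omega>. \<lambda>i\<in>{1..n}. Y i \<omega>)) ?B"
      by (rule measure_distr[symmetric]) (use R B in auto)
    also have "\<dots> = measure ?P ?B"
      using iid_joint_law[OF assms(1,5) n(1)] by (simp add: \<mu>_def)
    finally show ?thesis using main unfolding q_def by linarith
  qed
  \<comment> \<open>An explicit majorant: \<open>k n\<close> is replaced by \<open>ln n\<close>, and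
    the floor in \<open>m n\<close> is removed by the upper bound \<open>n powr (1/10)\<close> in
    the first term and by half of it as a lower bound in the second.\<close>
  define g where "g n = exp (- (real n * (c1 / (real n powr (1 / 10)) ^ 4)\<^sup>2 / 2)) +
    2 * ln (real n) ^ 3 / sqrt (real n powr (1 / 10))" for n
  have g: "g \<longlonglongrightarrow> 0"
    unfolding g_def using c1 by real_asymp
  have ev1: "\<forall>\<^sub>F n in sequentially. 4 * (real n powr (1 / 10)) ^ 5 \<le> c1 * real n"
    using c1 by real_asymp
  have L: "L \<ge> 0" using \<rho> by (simp add: L_def ln_le_zero_iff)
  \<comment> \<open>The lower bound for \<open>(4 * \<rho>) ^ k n\<close> is only polynomially small
    in \<open>n\<close>, so it eventually beats the exponential threshold.\<close>
  have ev2: "\<forall>\<^sub>F n in sequentially. exp (- \<epsilon> * real n) < exp (- L * ln (real n)) / 2"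
    using \<open>\<epsilon> > 0\<close> by real_asymp
  have ev3: "\<forall>\<^sub>F n in sequentially. real n powr (1 / 10) \<ge> 2" by real_asymp
  have ev4: "\<forall>\<^sub>F n in sequentially. ln (real n) / (5 * ln (ln (real n))) \<le> ln (real n)" by real_asymp
  have "\<forall>\<^sub>F n in sequentially. p n \<le> g n"
    using ev1 ev2 ev3 ev4 assms(7) eventually_gt_at_top[of 0]
  proof eventually_elim
    case (elim n)
    have ln0: "ln (real n) \<ge> 0" using elim by simp
    have kn: "real (k n) \<le> ln (real n)" using elim by linarith
    have m1: "real (m n) \<le> real n powr (1 / 10)" unfolding m_def by simp
    have m2: "real (m n) \<ge> real n powr (1 / 10) / 2" and m0: "m n > 0"
      using elim(3) unfolding m_def by linarith+
    have "4 * real (m n) ^ 5 \<le> 4 * (real n powr (1 / 10)) ^ 5"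
      using m1 by (intro mult_left_mono power_mono) auto
    then have m3: "4 * real (m n) ^ 5 \<le> c1 * real n" using elim by linarith
    have "exp (- L * ln (real n)) \<le> exp (- L * real (k n))"
      using kn L by (simp add: mult_left_mono)
    also have "\<dots> = exp (- L) ^ k n"
      by (simp add: mult.commute flip: exp_of_nat_mult)
    also have "exp (- L) = min 1 (4 * \<rho>)" using \<rho> by (simp add: L_def)
    also have "min 1 (4 * \<rho>) ^ k n \<le> (4 * \<rho>) ^ k n"
      using \<rho> by (intro power_mono) auto
    finally have "exp (- \<epsilon> * real n) < (4 * \<rho>) ^ k n / 2" using elim(2) by linarith
    from bound[OF _ m0 m3 this] elim have
      "p n \<le> exp (- (real n * (c1 / real (m n) ^ 4)\<^sup>2 / 2)) +
        2 * real (k n) ^ 3 / sqrt (2 * real (m n) + 1)"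
      by simp
    also have "\<dots> \<le> g n" unfolding g_def
    proof (rule add_mono)
      have "c1 / (real n powr (1 / 10)) ^ 4 \<le> c1 / real (m n) ^ 4"
        using m0 m1 c1 elim by (intro divide_left_mono power_mono) auto
      then show "exp (- (real n * (c1 / real (m n) ^ 4)\<^sup>2 / 2))
        \<le> exp (- (real n * (c1 / (real n powr (1 / 10)) ^ 4)\<^sup>2 / 2))"
        using c1 by (auto intro!: mult_left_mono power_mono)
      show "2 * real (k n) ^ 3 / sqrt (2 * real (m n) + 1) \<le> 2 * ln (real n) ^ 3 / sqrt (real n powr (1 / 10))"
        using kn m2 ln0 elim by (intro frac_le mult_left_mono power_mono real_sqrt_le_mono) auto
    qed
    finally show "p n \<le> g n" .
  qed
  then have "p \<longlonglongrightarrow> 0"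
    by (intro tendsto_sandwich[OF _ _ tendsto_const g]) (auto simp: p_def)
  then show ?thesis by (simp only: p_def[abs_def])
qed

end
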